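(* Let $\Omega$ be a $\sigma$-algebra of subsets of a set $X$, $E$ a $\sigma$-Dedekind complete Banach lattice, and $\pi\colon\mathcal B(X)\to\mathcal L_{\mathrm r}(E)$ a positive representation. If the norm dual $E'$ consists of $\sigma$-order continuous linear functionals only (equivalently: if $E$ has $\sigma$-order continuous norm), then the following are equivalent: (1) $\pi$ has a generating positive spectral measure on $\Omega$. (2) $\pi$ is $\sigma$-order continuous.
   Context: All vector spaces are real. $\mathcal B(X)$ is the Banach lattice algebra of bounded $\Omega$-measurable real-valued functions on $X$ (supremum norm, pointwise operations). $\mathcal L(E)$ denotes the bounded linear operators on $E$, and $\mathcal L_{\mathrm r}(E)\subset\mathcal L(E)$ the regular operators (differences of two positive linear operators) with the usual operator ordering ($T\geq0$ iff $Tx\geq 0$ for all $x\geq0$). A positive representation of $\mathcal B(X)$ on $E$ is an algebra homomorphism $\pi\colon\mathcal B(X)\to\mathcal L(E)$ with $\pi(\phi)$ a positive operator for every $\phi\geq0$; it need not be unital. In an ordered vector space, $v_n\uparrow v$ means $v_n\leq v_{n+1}$ for all $n\ge 1$ and $v=\sup_nv_n$. A positive linear map $\pi$ between ordered vector spaces is $\sigma$-order continuous if $v_n\uparrow v$ implies $\pi(v_n)\uparrow\pi(v)$; here $\pi$ is regarded as a map between the ordered vector spaces $\mathcal B(X)$ and $\mathcal L_{\mathrm r}(E)$. $E$ has $\sigma$-order continuous norm if $\|x_n\|\to0$ for every decreasing sequence $(x_n)$ in $E$ with infimum $0$. A positive spectral measure on $\Omega$ is a map $P\colon\Omega\to\mathcal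 L_{\mathrm r}(E)$ such that: each $P(\Delta)$ is a positive projection; $P(\emptyset)=0$; $P(\Delta_1\cap\Delta_2)=P(\Delta_1)P(\Delta_2)$ for all $\Delta_1,\Delta_2\in\Omega$; and for pairwise disjoint $\Delta_n\in\Omega$ ($n\geq1$) and $x\in E$ one has $P(\bigcup_n\Delta_n)x=\sum_nP(\Delta_n)x$ with norm convergence. The representation generated by $P$ is the unique bounded linear map $\pi_P\colon\mathcal B(X)\to(\mathcal L(E),\|\cdot\|)$ with $\pi_P(\chi_\Delta)=P(\Delta)$ for all $\Delta\in\Omega$; it is a positive representation with values in $\mathcal L_{\mathrm r}(E)$. The representation $\pi$ has generating positive spectral measure $P$ on $\Omega$ if $\pi=\pi_P$. *)

theory Defs
  imports "HOL-Analysis.Analysis" "HOL-Library.Lattice_Algebras"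
begin

section \<open>Banach lattices\<close>

class banach_lattice = banach + ordered_real_vector + lattice_ab_group_add_abs +
  assumes norm_mono: "\<bar>x\<bar> \<le> \<bar>y\<bar> \<Longrightarrow> norm x \<le> norm y"

instance real :: lattice_ab_group_add_abs
  by standard (auto simp: sup_real_def)

instance real :: banach_lattice
  by standard simp

definition sigma_Dedekind_complete :: "'e::order set \<Rightarrow> bool" where
  "sigma_Dedekind_complete V \<longleftrightarrow>
     (\<forall>A\<subseteq>V. countable A \<and> A \<noteq> {} \<and> (\<exists>u\<in>V. \<forall>a\<in>A. a \<le> u) \<longrightarrow>
        (\<exists>s\<in>V. (\<forall>a\<in>A. a \<le> s) \<and> (\<forall>u\<in>V. (\<forall>a\<in>A. a \<le> u) \<longrightarrow> s \<le> u)))"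

text \<open>
  \<open>increases_to V le v s\<close> is \<open>v\<^sub>n \<up> s\<close> in the set \<open>V\<close> ordered by \<open>le\<close>: the supremum
  is taken among the elements of \<open>V\<close> only.
\<close>

definition increases_to :: "'v set \<Rightarrow> ('v \<Rightarrow> 'v \<Rightarrow> bool) \<Rightarrow> (nat \<Rightarrow> 'v) \<Rightarrow> 'v \<Rightarrow> bool" where
  "increases_to V le v s \<longleftrightarrow>
     (\<forall>n. v n \<in> V) \<and> s \<in> V \<and>
     (\<forall>n. le (v n) (v (Suc n))) \<and>
     (\<forall>n. le (v n) s) \<and> (\<forall>u\<in>V. (\<forall>n. le (v n) u) \<longrightarrow> le s u)"

definition sigma_order_continuous ::
  "'v set \<Rightarrow> ('v \<Rightarrow> 'v \<Rightarrow> bool) \<Rightarrow> 'w set \<Rightarrow> ('w \<Rightarrow> 'w \<Rightarrow> bool) \<Rightarrow> ('v \<Rightarrow> 'w) \<Rightarrow> bool" where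
  "sigma_order_continuous V leV W leW T \<longleftrightarrow>
     (\<forall>v s. increases_to V leV v s \<longrightarrow> increases_to W leW (\<lambda>n. T (v n)) (T s))"

definition sigma_order_continuous_norm :: "'e::banach_lattice itself \<Rightarrow> bool" where
  "sigma_order_continuous_norm _ \<longleftrightarrow>
     (\<forall>x :: nat \<Rightarrow> 'e.
        (\<forall>n. x (Suc n) \<le> x n) \<and> (\<forall>n. 0 \<le> x n) \<and> (\<forall>l. (\<forall>n. l \<le> x n) \<longrightarrow> l \<le> 0) \<longrightarrow>
        (\<lambda>n. norm (x n)) \<longlonglongrightarrow> 0)"

text \<open>
  The elements of the norm dual need not be positive, so \<open>f (v n)\<close> need not be monotone; for a
  positive functional the condition says exactly that \<open>v\<^sub>n \<up> s\<close> implies \<open>f (v\<^sub>n) \<up> f s\<close>.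
\<close>

definition sigma_order_continuous_functional :: "('e::banach_lattice \<Rightarrow>\<^sub>L real) \<Rightarrow> bool" where
  "sigma_order_continuous_functional f \<longleftrightarrow>
     (\<forall>v s. increases_to UNIV (\<le>) v s \<longrightarrow> (\<lambda>n. blinfun_apply f (v n)) \<longlonglongrightarrow> blinfun_apply f s)"

section \<open>Regular operators\<close>

definition positive_map :: "('e::{zero,ord} \<Rightarrow> 'e) \<Rightarrow> bool" where
  "positive_map T \<longleftrightarrow> (\<forall>x\<ge>0. 0 \<le> T x)"

definition regular_operators :: "('e::banach_lattice \<Rightarrow>\<^sub>L 'e) set" where
  "regular_operators =
     {T. \<exists>S R. linear S \<and> positive_map S \<and> linear R \<and> positive_map R \<and>
           (\<forall>x. blinfun_apply T x = S x - R x)}"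

definition operator_le :: "('e::banach_lattice \<Rightarrow>\<^sub>L 'e) \<Rightarrow> ('e \<Rightarrow>\<^sub>L 'e) \<Rightarrow> bool" where
  "operator_le S T \<longleftrightarrow> positive_map (blinfun_apply (T - S))"

section \<open>Bounded measurable functions\<close>

text \<open>
  A function on \<open>X\<close> is represented by its extension by \<open>0\<close> to the whole type. The pointwise
  order, the algebra operations and the supremum norm on \<open>X\<close> then coincide with those on the
  type, also for empty \<open>X\<close>.
\<close>

definition bounded_measurable :: "'x set \<Rightarrow> 'x set set \<Rightarrow> ('x \<Rightarrow> real) set" where
  "bounded_measurable X \<Omega> =
     {\<phi> \<in> borel_measurable (sigma X \<Omega>). bounded (range \<phi>) \<and> (\<forall>x. x \<notin> X \<longrightarrow> \<phi> x = 0)}"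

definition sup_norm :: "('x \<Rightarrow> real) \<Rightarrow> real" where
  "sup_norm \<phi> = (SUP x. \<bar>\<phi> x\<bar>)"

definition linear_on_bounded_measurable ::
  "'x set \<Rightarrow> 'x set set \<Rightarrow> (('x \<Rightarrow> real) \<Rightarrow> 'v::real_vector) \<Rightarrow> bool" where
  "linear_on_bounded_measurable X \<Omega> \<pi> \<longleftrightarrow>
     (\<forall>\<phi>\<in>bounded_measurable X \<Omega>. \<forall>\<psi>\<in>bounded_measurable X \<Omega>.
        \<pi> (\<lambda>x. \<phi> x + \<psi> x) = \<pi> \<phi> + \<pi> \<psi>) \<and>
     (\<forall>\<phi>\<in>bounded_measurable X \<Omega>. \<forall>c. \<pi> (\<lambda>x. c * \<phi> x) = c *\<^sub>R \<pi> \<phi>)"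

definition positive_representation ::
  "'x set \<Rightarrow> 'x set set \<Rightarrow> (('x \<Rightarrow> real) \<Rightarrow> 'e::banach_lattice \<Rightarrow>\<^sub>L 'e) \<Rightarrow> bool" where
  "positive_representation X \<Omega> \<pi> \<longleftrightarrow>
     linear_on_bounded_measurable X \<Omega> \<pi> \<and>
     (\<forall>\<phi>\<in>bounded_measurable X \<Omega>. \<forall>\<psi>\<in>bounded_measurable X \<Omega>.
        \<pi> (\<lambda>x. \<phi> x * \<psi> x) = \<pi> \<phi> o\<^sub>L \<pi> \<psi>) \<and>
     (\<forall>\<phi>\<in>bounded_measurable X \<Omega>. (\<forall>x. 0 \<le> \<phi> x) \<longrightarrow> positive_map (blinfun_apply (\<pi> \<phi>)))"

section \<open>Positive spectral measures\<close>

definition positive_spectral_measure ::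
  "'x set set \<Rightarrow> ('x set \<Rightarrow> 'e::banach_lattice \<Rightarrow>\<^sub>L 'e) \<Rightarrow> bool" where
  "positive_spectral_measure \<Omega> P \<longleftrightarrow>
     (\<forall>\<Delta>\<in>\<Omega>. P \<Delta> \<in> regular_operators \<and> positive_map (blinfun_apply (P \<Delta>)) \<and> P \<Delta> o\<^sub>L P \<Delta> = P \<Delta>) \<and>
     P {} = 0 \<and>
     (\<forall>\<Delta>\<^sub>1\<in>\<Omega>. \<forall>\<Delta>\<^sub>2\<in>\<Omega>. P (\<Delta>\<^sub>1 \<inter> \<Delta>\<^sub>2) = P \<Delta>\<^sub>1 o\<^sub>L P \<Delta>\<^sub>2) \<and>
     (\<forall>\<Delta> :: nat \<Rightarrow> 'x set. range \<Delta> \<subseteq> \<Omega> \<and> disjoint_family \<Delta> \<longrightarrow>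
        (\<forall>x. (\<lambda>n. blinfun_apply (P (\<Delta> n)) x) sums blinfun_apply (P (\<Union>n. \<Delta> n)) x))"

text \<open>
  \<open>generated_by X \<Omega> P \<pi>\<close> says that \<open>\<pi>\<close> is the representation \<open>\<pi>\<^sub>P\<close> generated by \<open>P\<close>, that is,
  the bounded linear map on the bounded measurable functions which extends
  \<open>\<chi>\<^sub>\<Delta> \<mapsto> P \<Delta>\<close>. Such a map is unique, see \<open>generated_by_unique\<close> below.
\<close>

definition generated_by ::
  "'x set \<Rightarrow> 'x set set \<Rightarrow> ('x set \<Rightarrow> 'e::banach_lattice \<Rightarrow>\<^sub>L 'e) \<Rightarrow>
     (('x \<Rightarrow> real) \<Rightarrow> 'e \<Rightarrow>\<^sub>L 'e) \<Rightarrow> bool" where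
  "generated_by X \<Omega> P \<pi> \<longleftrightarrow>
     linear_on_bounded_measurable X \<Omega> \<pi> \<and>
     (\<exists>C. \<forall>\<phi>\<in>bounded_measurable X \<Omega>. norm (\<pi> \<phi>) \<le> C * sup_norm \<phi>) \<and>
     (\<forall>\<Delta>\<in>\<Omega>. \<pi> (indicat_real \<Delta>) = P \<Delta>)"

lemma indicator_bounded_measurable:
  assumes "sigma_algebra X \<Omega>" and "\<Delta> \<in> \<Omega>"
  shows "indicat_real \<Delta> \<in> bounded_measurable X \<Omega>"
proof -
  have sub: "\<Omega> \<subseteq> Pow X"
    using assms(1) by (simp add: sigma_algebra_iff2)
  have "\<Delta> \<in> sets (sigma X \<Omega>)"
    using assms sub by (simp add: sigma_algebra.sets_measure_of_eq)
  then have "indicat_real \<Delta> \<in> borel_measurable (sigma X \<Omega>)"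
    by (rule borel_measurable_indicator)
  moreover have "bounded (range (indicat_real \<Delta>))"
    by (rule boundedI[of _ 1]) (auto simp: indicator_def)
  moreover have "\<forall>x. x \<notin> X \<longrightarrow> indicat_real \<Delta> x = 0"
    using sub assms(2) by (auto simp: indicator_def)
  ultimately show ?thesis
    unfolding bounded_measurable_def by blast
qed

lemma bounded_measurable_add:
  assumes "\<phi> \<in> bounded_measurable X \<Omega>" and "\<psi> \<in> bounded_measurable X \<Omega>"
  shows "(\<lambda>x. \<phi> x + \<psi> x) \<in> bounded_measurable X \<Omega>"
  using assms by (auto simp: bounded_measurable_def intro!: bounded_plus_comp)

lemma bounded_measurable_scale:
  assumes "\<phi> \<in> bounded_measurable X \<Omega>"
  shows "(\<lambda>x. c * \<phi> x) \<in> bounded_measurable X \<Omega>"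
proof -
  have "bounded ((\<lambda>x. c *\<^sub>R x) ` range \<phi>)"
    using assms by (intro bounded_scaling) (simp add: bounded_measurable_def)
  then show ?thesis
    using assms unfolding bounded_measurable_def image_image
    by (auto intro!: borel_measurable_times)
qed

lemma bounded_measurable_simple_approx:
  assumes sa: "sigma_algebra X \<Omega>" and \<phi>: "\<phi> \<in> bounded_measurable X \<Omega>" and e: "e > 0"
  obtains K :: "int set" and c :: "int \<Rightarrow> real" and D :: "int \<Rightarrow> 'x set"
    where "finite K" "\<And>k. k \<in> K \<Longrightarrow> D k \<in> \<Omega>"
      "\<And>x. \<bar>\<phi> x - (\<Sum>k\<in>K. c k * indicat_real (D k) x)\<bar> \<le> e"
proof -
  obtain B where B: "\<And>x. \<bar>\<phi> x\<bar> \<le> B"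
    using \<phi> by (auto simp: bounded_measurable_def bounded_iff)
  define K where "K = {\<lfloor>- B / e\<rfloor>..\<lfloor>B / e\<rfloor>}"
  define D where "D k = {x \<in> X. \<lfloor>\<phi> x / e\<rfloor> = k}" for k
  have sub: "\<Omega> \<subseteq> Pow X"
    using sa by (simp add: sigma_algebra_iff2)
  have sp: "space (sigma X \<Omega>) = X" "sets (sigma X \<Omega>) = \<Omega>"
    using sub sa by (simp_all add: sigma_algebra.sigma_sets_eq)
  have [measurable]: "\<phi> \<in> borel_measurable (sigma X \<Omega>)"
    using \<phi> by (simp add: bounded_measurable_def)
  have DO: "D k \<in> \<Omega>" for k
  proof -
    have "{x \<in> space (sigma X \<Omega>). \<lfloor>\<phi> x / e\<rfloor> = k} \<in> sets (sigma X \<Omega>)"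
      by measurable
    then show ?thesis by (simp add: sp D_def)
  qed
  have approx: "\<bar>\<phi> x - (\<Sum>k\<in>K. (e * of_int k) * indicat_real (D k) x)\<bar> \<le> e" for x
  proof (cases "x \<in> X")
    case True
    let ?k = "\<lfloor>\<phi> x / e\<rfloor>"
    have "- B / e \<le> \<phi> x / e" "\<phi> x / e \<le> B / e"
      using B[of x] e by (auto simp: abs_le_iff field_simps)
    then have "?k \<in> K"
      unfolding K_def by (auto intro: floor_mono)
    moreover have "(e * of_int k) * indicat_real (D k) x = (if k = ?k then e * of_int k else 0)" for k
      using True by (auto simp: D_def)
    ultimately have "(\<Sum>k\<in>K. (e * of_int k) * indicat_real (D k) x) = e * of_int ?k"
      by (simp add: K_def)
    moreover have "e * of_int ?k \<le> \<phi> x"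
      using mult_left_mono[OF of_int_floor_le[of "\<phi> x / e"], of e] e by simp
    moreover have "\<phi> x \<le> e * of_int ?k + e"
      using mult_left_mono[of "\<phi> x / e" "of_int ?k + 1" e] e
        real_of_int_floor_add_one_ge[of "\<phi> x / e"] by (simp add: distrib_left)
    ultimately show ?thesis by linarith
  next
    case False
    then have "\<phi> x = 0" "\<And>k. indicat_real (D k) x = 0"
      using \<phi> by (auto simp: bounded_measurable_def D_def)
    then show ?thesis using e by simp
  qed
  show thesis
    by (rule that[of K D "\<lambda>k. e * of_int k"]) (use DO approx in \<open>auto simp: K_def\<close>)
qed

theorem generated_by_unique:
  assumes sa: "sigma_algebra X \<Omega>"
    and 1: "generated_by X \<Omega> P \<pi>" and 2: "generated_by X \<Omega> P \<rho>"
    and \<phi>: "\<phi> \<in> bounded_measurable X \<Omega>"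
  shows "\<pi> \<phi> = \<rho> \<phi>"
proof -
  let ?B = "bounded_measurable X \<Omega>"
  obtain C\<^sub>1 where C1: "\<And>\<psi>. \<psi> \<in> ?B \<Longrightarrow> norm (\<pi> \<psi>) \<le> C\<^sub>1 * sup_norm \<psi>"
    using 1 by (auto simp: generated_by_def)
  obtain C\<^sub>2 where C2: "\<And>\<psi>. \<psi> \<in> ?B \<Longrightarrow> norm (\<rho> \<psi>) \<le> C\<^sub>2 * sup_norm \<psi>"
    using 2 by (auto simp: generated_by_def)
  note add = bounded_measurable_add and scale = bounded_measurable_scale
  have lin: "\<And>\<psi> \<theta>. \<psi> \<in> ?B \<Longrightarrow> \<theta> \<in> ?B \<Longrightarrow> \<pi> (\<lambda>x. \<psi> x + \<theta> x) = \<pi> \<psi> + \<pi> \<theta>"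
    "\<And>\<psi> \<theta>. \<psi> \<in> ?B \<Longrightarrow> \<theta> \<in> ?B \<Longrightarrow> \<rho> (\<lambda>x. \<psi> x + \<theta> x) = \<rho> \<psi> + \<rho> \<theta>"
    "\<And>\<psi> c. \<psi> \<in> ?B \<Longrightarrow> \<pi> (\<lambda>x. c * \<psi> x) = c *\<^sub>R \<pi> \<psi>"
    "\<And>\<psi> c. \<psi> \<in> ?B \<Longrightarrow> \<rho> (\<lambda>x. c * \<psi> x) = c *\<^sub>R \<rho> \<psi>"
    using 1 2 by (auto simp: generated_by_def linear_on_bounded_measurable_def)
  have z: "(\<lambda>x. 0) \<in> ?B"
    using scale[OF \<phi>, of 0] by simp
  have z0: "\<pi> (\<lambda>x. 0) = 0" "\<rho> (\<lambda>x. 0) = 0"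
    using lin(3,4)[OF \<phi>, of 0] by simp_all
  have simple: "(\<lambda>x. \<Sum>k\<in>K. c k * indicat_real (D k) x) \<in> ?B \<and>
      \<pi> (\<lambda>x. \<Sum>k\<in>K. c k * indicat_real (D k) x) = \<rho> (\<lambda>x. \<Sum>k\<in>K. c k * indicat_real (D k) x)"
    if "finite K" "\<And>k. k \<in> K \<Longrightarrow> D k \<in> \<Omega>" for K :: "int set" and c D
    using that
  proof (induction K rule: finite_induct)
    case empty
    then show ?case using z z0 by simp
  next
    case (insert k K)
    have i: "indicat_real (D k) \<in> ?B"
      using insert.prems sa by (auto intro: indicator_bounded_measurable)
    have eq: "\<pi> (indicat_real (D k)) = \<rho> (indicat_real (D k))"
      using 1 2 insert.prems by (auto simp: generated_by_def)
    define s where "s = (\<lambda>x. \<Sum>k\<in>K. c k * indicat_real (D k) x)"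
    have s: "s \<in> ?B" "\<pi> s = \<rho> s"
      using insert by (auto simp: s_def)
    have ins: "(\<lambda>x. \<Sum>k\<in>insert k K. c k * indicat_real (D k) x) =
        (\<lambda>x. c k * indicat_real (D k) x + s x)"
      using insert.hyps by (simp add: s_def del: sum_mult_indicator)
    show ?case
      unfolding ins
      using add[OF scale[OF i] s(1)] lin(1,2)[OF scale[OF i] s(1)] lin(3,4)[OF i] eq s(2)
      by metis
  qed
  have "norm (\<pi> \<phi> - \<rho> \<phi>) \<le> (\<bar>C\<^sub>1\<bar> + \<bar>C\<^sub>2\<bar>) * e" if e: "e > 0" for e
  proof -
    obtain K :: "int set" and c D where K: "finite K" "\<And>k. k \<in> K \<Longrightarrow> D k \<in> \<Omega>"
      and ap: "\<And>x. \<bar>\<phi> x - (\<Sum>k\<in>K. c k * indicat_real (D k) x)\<bar> \<le> e"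
      using bounded_measurable_simple_approx[OF sa \<phi> e] by metis
    define s where "s = (\<lambda>x. \<Sum>k\<in>K. c k * indicat_real (D k) x)"
    have s: "s \<in> ?B" "\<pi> s = \<rho> s"
      using simple[OF K] by (auto simp: s_def)
    define d where "d = (\<lambda>x. \<phi> x + (- 1) * s x)"
    have d: "d \<in> ?B"
      unfolding d_def by (rule add[OF \<phi> scale[OF s(1)]])
    have "\<pi> d = \<pi> \<phi> - \<pi> s" "\<rho> d = \<rho> \<phi> - \<rho> s"
      unfolding d_def lin(1)[OF \<phi> scale[OF s(1)]] lin(2)[OF \<phi> scale[OF s(1)]]
        lin(3)[OF s(1)] lin(4)[OF s(1)] by simp_all
    then have "norm (\<pi> \<phi> - \<rho> \<phi>) = norm (\<pi> d - \<rho> d)"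
      using s(2) by simp
    also have "\<dots> \<le> norm (\<pi> d) + norm (\<rho> d)"
      by (rule norm_triangle_ineq4)
    also have "\<dots> \<le> (C\<^sub>1 + C\<^sub>2) * sup_norm d"
      using C1[OF d] C2[OF d] by (simp add: algebra_simps)
    also have "\<dots> \<le> (\<bar>C\<^sub>1\<bar> + \<bar>C\<^sub>2\<bar>) * e"
    proof (rule mult_mono)
      have de: "\<bar>d x\<bar> \<le> e" for x using ap[of x] by (simp add: d_def s_def)
      show "sup_norm d \<le> e"
        unfolding sup_norm_def by (rule cSUP_least) (use de in auto)
      have "0 \<le> \<bar>d undefined\<bar>" by simp
      also have "\<dots> \<le> sup_norm d"
        unfolding sup_norm_def by (rule cSUP_upper) (use de in \<open>auto intro!: bdd_aboveI2\<close>)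
      finally show "0 \<le> sup_norm d" .
    qed auto
    finally show ?thesis .
  qed
  then have "norm (\<pi> \<phi> - \<rho> \<phi>) \<le> 0 + e" if "e > 0" for e :: real
  proof -
    let ?C = "\<bar>C\<^sub>1\<bar> + \<bar>C\<^sub>2\<bar> + 1"
    have "norm (\<pi> \<phi> - \<rho> \<phi>) \<le> (\<bar>C\<^sub>1\<bar> + \<bar>C\<^sub>2\<bar>) * (e / ?C)"
      by (rule \<open>\<And>e. e > 0 \<Longrightarrow> _\<close>) (use that in \<open>simp add: add_nonneg_pos\<close>)
    also have "\<dots> \<le> ?C * (e / ?C)"
      by (rule mult_right_mono) (use that in auto)
    also have "\<dots> = e" by simp
    finally show ?thesis by simp
  qed
  then have "norm (\<pi> \<phi> - \<rho> \<phi>) \<le> 0"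
    by (rule field_le_epsilon)
  then show ?thesis by simp
qed

end

theory Submission
  imports Defs
begin

text \<open>The two forms of the hypothesis on \<open>E\<close> agree by a separation argument. If
  the norm is sigma-order continuous, order limits of increasing sequences are norm limits, which
  every bounded functional respects. Conversely, if a decreasing sequence \<open>x n\<close> with
  infimum 0 had norms at least \<open>e > 0\<close>, Hahn-Banach would give a bounded functional
  that is at least \<open>e\<close> on every \<open>x n\<close>
  (\<open>decreasing_sequence_functional\<close>), contradicting its continuity along
  \<open>- x n\<close>.

  From spectral measure to order continuity: an increasing sequence with a supremum in B(X)
  converges pointwise, because the pointwise supremum is again bounded and measurable. Cutting X
  where the difference exceeds \<open>e\<close> reduces norm convergence of \<pi>(\<phi>_n) z for
  \<open>0 <= z\<close> to P(A_n) z tending to 0 along sets decreasing to the empty set, which is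
  countable additivity (\<open>generated_representation_converges\<close>). As the positive cone is
  closed, the norm limit is the supremum.

  From order continuity to spectral measure: the only candidate is P(\<Delta>) =
  \<pi>(\<chi>_\<Delta>), and positivity alone bounds \<pi> in norm. Order continuity turns
  increasing unions into suprema among regular operators;
  \<open>increasing_operators_converge\<close> upgrades these to strong limits, which is countable
  additivity.\<close>

section \<open>The norm of a Banach lattice\<close>

lemma norm_mono_nonneg:
  fixes x y :: "'e::banach_lattice"
  assumes "0 \<le> x" "x \<le> y"
  shows "norm x \<le> norm y"
  using assms by (intro norm_mono) (simp add: order_trans[OF assms])

lemma norm_abs_lattice [simp]: "norm \<bar>x\<bar> = norm (x::'e::banach_lattice)"
  by (rule antisym; rule norm_mono) simp_all

lemma pprt_le_abs: "pprt x \<le> \<bar>x::'a::lattice_ab_group_add_abs\<bar>"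
  by (simp add: pprt_def abs_ge_self)

lemma norm_pprt_le: "norm (pprt x) \<le> norm (x::'e::banach_lattice)"
  using norm_mono_nonneg[OF zero_le_pprt pprt_le_abs, of x] by simp

text \<open>The positive cone is norm closed: \<open>- l <= x n - l\<close>, so the positive part of
  \<open>- l\<close> is dominated by that of \<open>x n - l\<close>, whose norm tends to 0.\<close>

lemma LIMSEQ_nonneg:
  fixes x :: "nat \<Rightarrow> 'e::banach_lattice"
  assumes lim: "x \<longlonglongrightarrow> l" and nn: "\<And>n. 0 \<le> x n"
  shows "0 \<le> l"
proof -
  have "norm (pprt (- l)) \<le> norm (x n - l)" for n
  proof -
    have "pprt (- l) \<le> pprt (x n - l)"
      using nn[of n] by (intro pprt_mono) simp
    from norm_mono_nonneg[OF zero_le_pprt this] norm_pprt_le[of "x n - l"]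
    show ?thesis by simp
  qed
  moreover have "(\<lambda>n. norm (x n - l)) \<longlonglongrightarrow> 0"
    using lim by (simp add: LIM_zero tendsto_norm_zero)
  ultimately have "norm (pprt (- l)) \<le> 0"
    by (intro LIMSEQ_le_const) auto
  then have "- l \<le> 0" by (simp add: le_zero_iff_zero_pprt)
  then show ?thesis by simp
qed

lemma LIMSEQ_mono:
  fixes x y :: "nat \<Rightarrow> 'e::banach_lattice"
  assumes "x \<longlonglongrightarrow> a" "y \<longlonglongrightarrow> b" "\<And>n. x n \<le> y n"
  shows "a \<le> b"
  using LIMSEQ_nonneg[OF tendsto_diff[OF assms(2,1)]] assms(3) by simp

section \<open>The Hahn--Banach theorem\<close>

definition sublinear :: "('a::real_vector \<Rightarrow> real) \<Rightarrow> bool" where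
  "sublinear p \<longleftrightarrow>
     (\<forall>x y. p (x + y) \<le> p x + p y) \<and> (\<forall>c\<ge>0. \<forall>x. p (c *\<^sub>R x) = c * p x)"

lemma sublinear_add: "sublinear p \<Longrightarrow> p (x + y) \<le> p x + p y"
  by (simp add: sublinear_def)

lemma sublinear_scale: "sublinear p \<Longrightarrow> 0 \<le> c \<Longrightarrow> p (c *\<^sub>R x) = c * p x"
  by (simp add: sublinear_def)

lemma sublinear_zero: "sublinear p \<Longrightarrow> p 0 = 0"
  using sublinear_scale[of p 0] by simp

lemma sublinear_neg: "sublinear p \<Longrightarrow> - p (- x) \<le> p x"
  using sublinear_add[of p x "- x"] sublinear_zero[of p] by simp

text \<open>The estimates are asked for only up to a change of index, so that one lemma serves
  chains of functionals as well as the parametrised gauges below. An inequality suffices for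
  scaling: applied to \<open>1 / c\<close> it yields the reverse one.\<close>

lemma sublinear_INF:
  fixes F :: "'i \<Rightarrow> 'a::real_vector \<Rightarrow> real"
  assumes ne: "I \<noteq> {}"
    and bdd: "\<And>x. bdd_below ((\<lambda>i. F i x) ` I)"
    and add: "\<And>i j x y. i \<in> I \<Longrightarrow> j \<in> I \<Longrightarrow> \<exists>k\<in>I. F k (x + y) \<le> F i x + F j y"
    and scale: "\<And>i c x. i \<in> I \<Longrightarrow> 0 < c \<Longrightarrow> \<exists>k\<in>I. F k (c *\<^sub>R x) \<le> c * F i x"
    and zero: "\<And>i. i \<in> I \<Longrightarrow> 0 \<le> F i 0" "\<exists>i\<in>I. F i 0 \<le> 0"
  shows "sublinear (\<lambda>x. INF i\<in>I. F i x)"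
proof -
  define p where "p x = (INF i\<in>I. F i x)" for x
  have low: "p x \<le> F i x" if "i \<in> I" for x i
    unfolding p_def by (rule cINF_lower[OF bdd that])
  have great: "c \<le> p x" if "\<And>i. i \<in> I \<Longrightarrow> c \<le> F i x" for x c
    unfolding p_def by (rule cINF_greatest[OF ne that])
  have "p (x + y) \<le> p x + p y" for x y
  proof -
    have "p (x + y) - F j y \<le> p x" if j: "j \<in> I" for j
    proof (rule great)
      fix i assume "i \<in> I"
      then obtain k where "k \<in> I" "F k (x + y) \<le> F i x + F j y" using add j by blast
      then show "p (x + y) - F j y \<le> F i x" using low[of k "x + y"] by simp
    qed
    then have "p (x + y) - p x \<le> p y" by (intro great) (simp add: algebra_simps)
    then show ?thesis by simp
  qed
  moreover have half: "p (c *\<^sub>R x) \<le> c * p x" if c: "0 < c" for c x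
  proof -
    have "p (c *\<^sub>R x) / c \<le> p x"
    proof (rule great)
      fix i assume "i \<in> I"
      then obtain k where "k \<in> I" "F k (c *\<^sub>R x) \<le> c * F i x" using scale c by blast
      then show "p (c *\<^sub>R x) / c \<le> F i x"
        using low[of k "c *\<^sub>R x"] c by (simp add: field_simps)
    qed
    then show ?thesis using c by (simp add: field_simps)
  qed
  moreover have "c * p x \<le> p (c *\<^sub>R x)" if c: "0 < c" for c x
    using half[of "1 / c" "c *\<^sub>R x"] c by (simp add: field_simps)
  moreover have "p 0 = 0"
    using zero low[of _ 0] by (intro antisym great) (force intro: order_trans)+
  ultimately have "sublinear p"
    unfolding sublinear_def by (metis antisym mult_zero_left order_le_less scaleR_zero_left)
  then show ?thesis by (simp add: p_def[abs_def])
qed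

text \<open>The witness is the infimum of \<open>q (y + t *\<^sub>R x) - t * q x\<close> over
  \<open>0 <= t\<close>; the values \<open>t = 0\<close> and \<open>t = 1\<close> give the two upper
  bounds.\<close>

lemma sublinear_tilt:
  assumes q: "sublinear q"
  obtains r where "sublinear r" "\<And>y. r y \<le> q y" "\<And>y. r y \<le> q (y + x) - q x"
proof -
  define F where "F t y = q (y + t *\<^sub>R x) - t * q x" for t y
  have bdd: "bdd_below ((\<lambda>t. F t y) ` {0..})" for y
  proof (rule bdd_belowI2)
    fix t :: real assume "t \<in> {0..}"
    then show "- q (- y) \<le> F t y"
      using sublinear_add[OF q, of "y + t *\<^sub>R x" "- y"] sublinear_scale[OF q, of t x]
      by (simp add: F_def)
  qed
  define r where "r y = (INF t\<in>{0..}. F t y)" for y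
  have low: "r y \<le> F t y" if "0 \<le> t" for y t
    unfolding r_def by (rule cINF_lower[OF bdd]) (use that in simp)
  have "sublinear r"
    unfolding r_def
  proof (rule sublinear_INF)
    fix i j :: real and y z assume "i \<in> {0..}" "j \<in> {0..}"
    then show "\<exists>k\<in>{0..}. F k (y + z) \<le> F i y + F j z"
      using sublinear_add[OF q, of "y + i *\<^sub>R x" "z + j *\<^sub>R x"]
      by (intro bexI[of _ "i + j"]) (auto simp: F_def algebra_simps)
  next
    fix i c :: real and y assume "i \<in> {0..}" "0 < c"
    then show "\<exists>k\<in>{0..}. F k (c *\<^sub>R y) \<le> c * F i y"
      using sublinear_scale[OF q, of c "y + i *\<^sub>R x"]
      by (intro bexI[of _ "c * i"]) (auto simp: F_def algebra_simps)
  qed (use bdd sublinear_scale[OF q] sublinear_zero[OF q] in \<open>auto simp: F_def\<close>)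
  moreover have "r y \<le> q y" for y
    using low[of 0 y] by (simp add: F_def)
  moreover have "r y \<le> q (y + x) - q x" for y
    using low[of 1 y] by (simp add: F_def)
  ultimately show thesis by (rule that)
qed

text \<open>
  The dominated functional is a minimal sublinear functional below \<open>p\<close>: tilting it in the
  direction \<open>x\<close> cannot make it smaller, which forces additivity.
\<close>

theorem Hahn_Banach_dominated:
  assumes p: "sublinear p"
  obtains f where "linear f" "\<And>x. f x \<le> p x"
proof -
  define A where "A = {q. sublinear q \<and> (\<forall>x. q x \<le> p x)}"
  \<comment> \<open>The order is the reversed pointwise one, so a maximal element from Zorn's lemma
    is a minimal sublinear functional, and the bound of a chain is its pointwise infimum.\<close>
  define P where "P q r \<longleftrightarrow> (\<forall>x. r x \<le> q x)" for q r :: "'a \<Rightarrow> real"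
  have pA: "p \<in> A" using p by (simp add: A_def)
  have "\<exists>m\<in>A. \<forall>a\<in>A. P m a \<longrightarrow> a = m"
  proof (rule predicate_Zorn)
    show "partial_order_on A (relation_of P A)"
      by (rule partial_order_on_relation_ofI)
         (auto simp: P_def fun_eq_iff intro: order_trans antisym)
  next
    fix C assume C: "C \<in> Chains (relation_of P A)"
    then have CA: "C \<subseteq> A" and tot: "\<And>a b. a \<in> C \<Longrightarrow> b \<in> C \<Longrightarrow> P a b \<or> P b a"
      by (auto simp: Chains_def relation_of_def)
    show "\<exists>u\<in>A. \<forall>a\<in>C. P a u"
    proof (cases "C = {}")
      case True
      then show ?thesis using pA by auto
    next
      case False
      have bdd: "bdd_below ((\<lambda>q. q x) ` C)" for x
      proof (rule bdd_belowI2)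
        fix q assume "q \<in> C"
        then have "sublinear q" "q (- x) \<le> p (- x)" using CA by (auto simp: A_def)
        then show "- p (- x) \<le> q x" using sublinear_neg[of q x] by simp
      qed
      have low: "(INF q\<in>C. q x) \<le> q x" if "q \<in> C" for q x
        by (rule cINF_lower[OF bdd that])
      have "sublinear (\<lambda>x. INF q\<in>C. q x)"
      proof (rule sublinear_INF)
        fix i j :: "'a \<Rightarrow> real" and x y assume ij: "i \<in> C" "j \<in> C"
        then have sub: "sublinear i" "sublinear j" using CA by (auto simp: A_def)
        from tot[OF ij] show "\<exists>k\<in>C. k (x + y) \<le> i x + j y"
        proof
          assume "P i j"
          then have "j x \<le> i x" by (simp add: P_def)
          then show ?thesis
            using ij sublinear_add[OF sub(2), of x y] by (intro bexI[of _ j]) auto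
        next
          assume "P j i"
          then have "i y \<le> j y" by (simp add: P_def)
          then show ?thesis
            using ij sublinear_add[OF sub(1), of x y] by (intro bexI[of _ i]) auto
        qed
      next
        fix i :: "'a \<Rightarrow> real" and c x assume "i \<in> C" "0 < (c::real)"
        then show "\<exists>k\<in>C. k (c *\<^sub>R x) \<le> c * i x"
          using CA sublinear_scale[of i c x] by (intro bexI[of _ i]) (auto simp: A_def)
      next
        show "0 \<le> i 0" if "i \<in> C" for i
          using CA that sublinear_zero[of i] by (auto simp: A_def)
        show "\<exists>i\<in>C. i 0 \<le> 0"
          using False CA sublinear_zero by (force simp: A_def)
      qed (use False bdd in auto)
      moreover have "(INF q\<in>C. q x) \<le> p x" for x
      proof -
        obtain q where "q \<in> C" using False by auto
        then have "q x \<le> p x" using CA by (auto simp: A_def)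
        then show ?thesis using low[OF \<open>q \<in> C\<close>, of x] by simp
      qed
      ultimately show ?thesis
        using low by (intro bexI[of _ "\<lambda>x. INF q\<in>C. q x"]) (auto simp: A_def P_def)
    qed
  qed
  then obtain m where m: "sublinear m" "\<And>x. m x \<le> p x"
    and minimal: "\<And>a. a \<in> A \<Longrightarrow> P m a \<Longrightarrow> a = m"
    by (auto simp: A_def)
  have add: "m (y + x) = m y + m x" for x y
  proof -
    obtain r where r: "sublinear r" "\<And>y. r y \<le> m y" "\<And>y. r y \<le> m (y + x) - m x"
      using sublinear_tilt[OF m(1)] by metis
    then have "r \<in> A" using m(2) by (auto simp: A_def intro: order_trans)
    then have "r = m" using r(2) by (intro minimal) (simp_all add: P_def)
    then show ?thesis
      using r(3)[of y] sublinear_add[OF m(1), of y x] by simp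
  qed
  have neg: "m (- x) = - m x" for x
    using add[of x "- x"] sublinear_zero[OF m(1)] by simp
  have "m (c *\<^sub>R x) = c *\<^sub>R m x" for c x
  proof (cases "0 \<le> c")
    case True
    then show ?thesis using sublinear_scale[OF m(1)] by simp
  next
    case False
    then have "m ((- c) *\<^sub>R x) = - c * m x" by (intro sublinear_scale[OF m(1)]) simp
    then show ?thesis using neg[of "c *\<^sub>R x"] by simp
  qed
  then have "linear m" by (intro linearI add)
  then show thesis using m(2) that by blast
qed

section \<open>Sigma-order continuity of the norm\<close>

text \<open>
  Every point of the convex hull of a decreasing sequence dominates some member of it, so its norm
  is at least \<open>e\<close>; the sublinear functional below is the corresponding separating gauge.
\<close>

lemma decreasing_sequence_functional:
  fixes x :: "nat \<Rightarrow> 'e::banach_lattice"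
  assumes dec: "\<And>n. x (Suc n) \<le> x n" and nn: "\<And>n. 0 \<le> x n"
    and e: "0 \<le> e" "\<And>n. e \<le> norm (x n)"
  obtains f :: "'e \<Rightarrow>\<^sub>L real" where "\<And>n. e \<le> f (x n)"
proof -
  define I :: "(real \<times> nat) set" where "I = {0..} \<times> UNIV"
  \<comment> \<open>Index \<open>(0, 0)\<close> will give \<open>f y <= norm y\<close>, and index
    \<open>(1, n)\<close> at \<open>- x n\<close> will give \<open>f (- x n) <= - e\<close>. The
    positive part makes the gauge monotone in its vector argument.\<close>
  define F where "F = (\<lambda>(t, n) y. norm (pprt (y + t *\<^sub>R x n)) - t * e)"
  have anti: "x m \<le> x n" if "n \<le> m" for n m
    using lift_Suc_antimono_le[of x, OF dec that] .
  \<comment> \<open>This is where the norms being at least \<open>e\<close> enters: since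
    \<open>t *\<^sub>R x n\<close> lies below the sum of the positive parts of
    \<open>y + t *\<^sub>R x n\<close> and \<open>- y\<close>, the term \<open>t * e\<close> is
    compensated up to \<open>norm y\<close>, and the infimum is finite.\<close>
  have below: "- norm y \<le> F i y" if "i \<in> I" for i y
  proof -
    obtain t n where i: "i = (t, n)" and t: "0 \<le> t" using \<open>i \<in> I\<close> by (auto simp: I_def)
    have "t * e \<le> norm (t *\<^sub>R x n)"
      using t e(2)[of n] by (simp add: mult_left_mono)
    also have "\<dots> \<le> norm (pprt (y + t *\<^sub>R x n) + pprt (- y))"
    proof (rule norm_mono_nonneg)
      show "0 \<le> t *\<^sub>R x n" using t nn by (simp add: scaleR_nonneg_nonneg)
      have "(y + t *\<^sub>R x n) + - y \<le> pprt (y + t *\<^sub>R x n) + pprt (- y)"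
        by (intro add_mono) (simp_all add: pprt_def)
      then show "t *\<^sub>R x n \<le> pprt (y + t *\<^sub>R x n) + pprt (- y)" by simp
    qed
    also have "\<dots> \<le> norm (pprt (y + t *\<^sub>R x n)) + norm y"
      using norm_triangle_ineq[of "pprt (y + t *\<^sub>R x n)" "pprt (- y)"] norm_pprt_le[of "- y"]
      by simp
    finally show ?thesis by (simp add: i F_def)
  qed
  have bdd: "bdd_below ((\<lambda>i. F i y) ` I)" for y
    using below by (intro bdd_belowI2)
  define p where "p y = (INF i\<in>I. F i y)" for y
  have low: "p y \<le> F i y" if "i \<in> I" for y i
    unfolding p_def by (rule cINF_lower[OF bdd that])
  have "sublinear p"
    unfolding p_def
  proof (rule sublinear_INF)
    fix i j y z assume "i \<in> I" "j \<in> I"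
    then obtain t n s m where ij: "i = (t, n)" "j = (s, m)" and ts: "0 \<le> t" "0 \<le> s"
      by (auto simp: I_def)
    \<comment> \<open>As the sequence decreases, \<open>x k\<close> lies below both
      \<open>x n\<close> and \<open>x m\<close>, so a combination of two members dominates a
      multiple of a single one.\<close>
    define k where "k = max n m"
    have "(t + s) *\<^sub>R x k \<le> t *\<^sub>R x n + s *\<^sub>R x m"
      unfolding scaleR_add_left using ts
      by (intro add_mono scaleR_left_mono anti) (auto simp: k_def)
    then have "y + z + (t + s) *\<^sub>R x k \<le> (y + t *\<^sub>R x n) + (z + s *\<^sub>R x m)"
      by (simp add: algebra_simps)
    also have "\<dots> \<le> pprt (y + t *\<^sub>R x n) + pprt (z + s *\<^sub>R x m)"
      by (intro add_mono) (simp_all add: pprt_def)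
    finally have "pprt (y + z + (t + s) *\<^sub>R x k) \<le> pprt (y + t *\<^sub>R x n) + pprt (z + s *\<^sub>R x m)"
      unfolding pprt_def[of "y + z + (t + s) *\<^sub>R x k"] by simp
    from norm_mono_nonneg[OF zero_le_pprt this]
    have "norm (pprt (y + z + (t + s) *\<^sub>R x k))
        \<le> norm (pprt (y + t *\<^sub>R x n)) + norm (pprt (z + s *\<^sub>R x m))"
      using norm_triangle_ineq order_trans by blast
    then have "F (t + s, k) (y + z) \<le> F i y + F j z"
      by (simp add: F_def ij algebra_simps)
    then show "\<exists>k\<in>I. F k (y + z) \<le> F i y + F j z"
      using ts by (intro bexI[of _ "(t + s, k)"]) (auto simp: I_def)
  next
    fix i and c :: real and y assume "i \<in> I" and c: "0 < c"
    then obtain t n where i: "i = (t, n)" and t: "0 \<le> t" by (auto simp: I_def)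
    have "pprt (c *\<^sub>R y + (c * t) *\<^sub>R x n) \<le> c *\<^sub>R pprt (y + t *\<^sub>R x n)"
    proof -
      have "c *\<^sub>R (y + t *\<^sub>R x n) \<le> c *\<^sub>R pprt (y + t *\<^sub>R x n)"
        using c by (intro scaleR_left_mono) (simp_all add: pprt_def)
      moreover have "0 \<le> c *\<^sub>R pprt (y + t *\<^sub>R x n)"
        using c by (intro scaleR_nonneg_nonneg) simp_all
      ultimately show ?thesis
        by (simp add: pprt_def[of "c *\<^sub>R y + (c * t) *\<^sub>R x n"] scaleR_add_right)
    qed
    from norm_mono_nonneg[OF zero_le_pprt this]
    have "F (c * t, n) (c *\<^sub>R y) \<le> c * F i y"
      using c by (simp add: F_def i algebra_simps)
    then show "\<exists>k\<in>I. F k (c *\<^sub>R y) \<le> c * F i y"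
      using c t by (intro bexI[of _ "(c * t, n)"]) (auto simp: I_def)
  next
    show "0 \<le> F i 0" if "i \<in> I" for i using below[OF that, of 0] by simp
    show "\<exists>i\<in>I. F i 0 \<le> 0"
      by (rule bexI[of _ "(0, 0)"]) (auto simp: I_def F_def)
  qed (use bdd in \<open>auto simp: I_def\<close>)
  then obtain f where f: "linear f" "\<And>y. f y \<le> p y"
    using Hahn_Banach_dominated by blast
  have up: "f y \<le> norm y" for y
    using f(2)[of y] low[of "(0, 0)" y] norm_pprt_le[of y] by (simp add: I_def F_def)
  have "norm (f y) \<le> norm y * 1" for y
    using up[of y] up[of "- y"] linear_neg[OF f(1), of y] by (simp add: abs_le_iff)
  then have "bounded_linear f"
    using linear_add[OF f(1)] linear_scale[OF f(1)] by (intro bounded_linear_intro[of f 1]) auto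
  then have f': "blinfun_apply (Blinfun f) = f" by (rule bounded_linear_Blinfun_apply)
  have "e \<le> f (x n)" for n
    using f(2)[of "- x n"] low[of "(1, n)" "- x n"] linear_neg[OF f(1), of "x n"]
    by (simp add: I_def F_def)
  then show thesis using that[of "Blinfun f"] f' by simp
qed

text \<open>The differences \<open>s - v n\<close> decrease and have infimum 0.\<close>

lemma sigma_order_continuous_norm_increases:
  fixes v :: "nat \<Rightarrow> 'e::banach_lattice"
  assumes norm: "sigma_order_continuous_norm TYPE('e)" and v: "increases_to UNIV (\<le>) v s"
  shows "v \<longlonglongrightarrow> s"
proof -
  have mono: "\<And>n. v n \<le> v (Suc n)" and ub: "\<And>n. v n \<le> s"
    and least: "\<And>u. (\<And>n. v n \<le> u) \<Longrightarrow> s \<le> u"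
    using v by (auto simp: increases_to_def)
  have "l \<le> 0" if l: "\<And>n. l \<le> s - v n" for l
    using least[of "s - l"] l by (simp add: algebra_simps)
  then have "(\<lambda>n. norm (s - v n)) \<longlonglongrightarrow> 0"
    using norm[unfolded sigma_order_continuous_norm_def, rule_format, of "\<lambda>n. s - v n"] mono ub
    by (simp add: diff_left_mono)
  then have "(\<lambda>n. s - v n) \<longlonglongrightarrow> 0" by (rule tendsto_norm_zero_cancel)
  from tendsto_diff[OF tendsto_const[of s] this] show ?thesis by simp
qed

lemma sigma_order_continuous_functional_iff_norm:
  "(\<forall>f :: 'e::banach_lattice \<Rightarrow>\<^sub>L real. sigma_order_continuous_functional f) \<longleftrightarrow>
     sigma_order_continuous_norm TYPE('e)"
proof
  assume "sigma_order_continuous_norm TYPE('e)"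
  then show "\<forall>f :: 'e \<Rightarrow>\<^sub>L real. sigma_order_continuous_functional f"
    using sigma_order_continuous_norm_increases
    by (auto simp: sigma_order_continuous_functional_def intro!: tendsto_intros)
next
  assume cont: "\<forall>f :: 'e \<Rightarrow>\<^sub>L real. sigma_order_continuous_functional f"
  show "sigma_order_continuous_norm TYPE('e)"
    unfolding sigma_order_continuous_norm_def
  proof (intro allI impI, elim conjE)
    fix x :: "nat \<Rightarrow> 'e"
    assume dec: "\<forall>n. x (Suc n) \<le> x n" and nn: "\<forall>n. 0 \<le> x n"
      and inf: "\<forall>l. (\<forall>n. l \<le> x n) \<longrightarrow> l \<le> 0"
    \<comment> \<open>Continuity of functionals is phrased for increasing sequences, hence the
      change of sign.\<close>
    have inc: "increases_to UNIV (\<le>) (\<lambda>n. - x n) 0"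
      unfolding increases_to_def using dec nn inf
      by (auto simp: minus_le_iff)
    have norm_dec: "norm (x m) \<le> norm (x n)" if "n \<le> m" for n m
      using lift_Suc_antimono_le[of x n m] dec nn that by (intro norm_mono_nonneg) auto
    show "(\<lambda>n. norm (x n)) \<longlonglongrightarrow> 0"
    proof (rule LIMSEQ_I)
      fix e :: real assume e: "0 < e"
      have "\<exists>N. norm (x N) < e"
      proof (rule ccontr)
        assume "\<nexists>N. norm (x N) < e"
        then obtain f :: "'e \<Rightarrow>\<^sub>L real" where f: "\<And>n. e \<le> f (x n)"
          using decreasing_sequence_functional[of x e] dec nn e by (metis less_imp_le not_le)
        have "(\<lambda>n. f (- x n)) \<longlonglongrightarrow> f 0"
          using cont[unfolded sigma_order_continuous_functional_def, rule_format, OF inc] .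
        then have "(\<lambda>n. - f (- x n)) \<longlonglongrightarrow> 0"
          using tendsto_minus by (force simp: blinfun.zero_right)
        then have "e \<le> 0"
          using f by (intro LIMSEQ_le_const) (auto simp: blinfun.minus_right)
        then show False using e by simp
      qed
      then show "\<exists>N. \<forall>n\<ge>N. norm (norm (x n) - 0) < e"
        using norm_dec by (auto intro: le_less_trans)
    qed
  qed
qed

section \<open>Sequences of positive operators\<close>

lemma operator_le_iff: "operator_le S T \<longleftrightarrow> (\<forall>x\<ge>0. blinfun_apply S x \<le> blinfun_apply T x)"
  by (simp add: operator_le_def positive_map_def blinfun.diff_left)

lemma positive_map_imp_regular:
  "positive_map (blinfun_apply T) \<Longrightarrow> T \<in> regular_operators"
  unfolding regular_operators_def mem_Collect_eq
  by (intro exI[of _ "blinfun_apply T"] exI[of _ "\<lambda>_. 0"] conjI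
        bounded_linear.linear[OF blinfun.bounded_linear_right] linear_zero)
     (simp_all add: positive_map_def)

text \<open>Here \<open>nprt x\<close> is the infimum of \<open>x\<close> and 0, so
  \<open>- nprt x\<close> is the usual negative part. Statements known on the positive cone extend
  to all vectors through this splitting.\<close>

lemma blinfun_apply_prts:
  fixes x :: "'e::banach_lattice"
  shows "blinfun_apply T x = blinfun_apply T (pprt x) - blinfun_apply T (- nprt x)"
proof -
  have "blinfun_apply T (pprt x + nprt x) = blinfun_apply T (pprt x) + blinfun_apply T (nprt x)"
    by (rule blinfun.add_right)
  then show ?thesis by (simp add: prts[symmetric] blinfun.minus_right)
qed

text \<open>Splitting \<open>x\<close> into its positive and negative parts gives
  \<open>\<bar>T x\<bar> \<le> S \<bar>x\<bar>\<close>, and the lattice norm is monotone.\<close>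

lemma norm_le_of_dominated:
  fixes S T :: "'e::banach_lattice \<Rightarrow>\<^sub>L 'e"
  assumes dom: "\<And>x. 0 \<le> x \<Longrightarrow> \<bar>T x\<bar> \<le> S x"
  shows "norm (T x) \<le> norm S * norm x"
proof -
  have "\<bar>T x\<bar> \<le> \<bar>T (pprt x)\<bar> + \<bar>T (- nprt x)\<bar>"
    unfolding blinfun_apply_prts[of T x] by (rule abs_triangle_ineq4)
  also have "\<dots> \<le> S (pprt x) + S (- nprt x)"
    by (intro add_mono dom) simp_all
  also have "\<dots> = S \<bar>x\<bar>"
    by (simp add: abs_prts blinfun.add_right blinfun.minus_right blinfun.diff_right)
  finally have "norm \<bar>T x\<bar> \<le> norm (S \<bar>x\<bar>)"
    by (intro norm_mono_nonneg) simp_all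
  also have "\<dots> \<le> norm S * norm x"
    using norm_blinfun[of S "\<bar>x\<bar>"] by simp
  finally show ?thesis by simp
qed

text \<open>
  By sigma-Dedekind completeness and continuity of the norm, the sequence converges strongly; its
  limit is a regular upper bound below \<open>S\<close>, hence equal to \<open>S\<close>.
\<close>

lemma increasing_operators_converge:
  fixes T :: "nat \<Rightarrow> 'e::banach_lattice \<Rightarrow>\<^sub>L 'e"
  assumes complete: "sigma_Dedekind_complete (UNIV :: 'e set)"
    and norm: "sigma_order_continuous_norm TYPE('e)"
    and pos: "\<And>n. positive_map (T n)"
    and inc: "increases_to regular_operators operator_le T S"
  shows "(\<lambda>n. T n x) \<longlonglongrightarrow> S x"
proof -
  have mono: "\<And>n x. 0 \<le> x \<Longrightarrow> T n x \<le> T (Suc n) x"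
    and ub: "\<And>n x. 0 \<le> x \<Longrightarrow> T n x \<le> S x"
    and least: "\<And>U. U \<in> regular_operators \<Longrightarrow> (\<And>n. operator_le (T n) U) \<Longrightarrow> operator_le S U"
    using inc by (auto simp: increases_to_def operator_le_iff)
  have pos': "0 \<le> T n x" if "0 \<le> x" for n x
    using pos[of n] that by (simp add: positive_map_def)
  have conv: "\<exists>l. (\<lambda>n. T n x) \<longlonglongrightarrow> l \<and> (\<forall>n. T n x \<le> l)" if x: "0 \<le> x" for x
  proof -
    have "\<exists>u\<in>UNIV. \<forall>a\<in>range (\<lambda>n. T n x). a \<le> u" using ub[OF x] by blast
    then obtain s where "\<forall>a\<in>range (\<lambda>n. T n x). a \<le> s"
      "\<forall>u. (\<forall>a\<in>range (\<lambda>n. T n x). a \<le> u) \<longrightarrow> s \<le> u"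
      using complete[unfolded sigma_Dedekind_complete_def, rule_format, of "range (\<lambda>n. T n x)"]
      by auto
    then have "increases_to UNIV (\<le>) (\<lambda>n. T n x) s" and "\<forall>n. T n x \<le> s"
      using mono[OF x] by (auto simp: increases_to_def)
    then show ?thesis using sigma_order_continuous_norm_increases[OF norm] by blast
  qed
  define R where "R x = lim (\<lambda>n. T n x)" for x
  have R: "(\<lambda>n. T n x) \<longlonglongrightarrow> R x" for x
  proof -
    obtain a b where "(\<lambda>n. T n (pprt x)) \<longlonglongrightarrow> a" "(\<lambda>n. T n (- nprt x)) \<longlonglongrightarrow> b"
      using conv[of "pprt x"] conv[of "- nprt x"] by auto
    then have "(\<lambda>n. T n x) \<longlonglongrightarrow> a - b"
      unfolding blinfun_apply_prts[of _ x] by (rule tendsto_diff)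
    then show ?thesis unfolding R_def by (simp add: limI)
  qed
  \<comment> \<open>All \<open>T n\<close> lie between 0 and \<open>S\<close> on the cone, so
    \<open>norm S\<close> bounds them uniformly and their pointwise limit is a bounded
    operator.\<close>
  have bound: "norm (R x) \<le> norm x * norm S" for x
  proof (rule LIMSEQ_le_const2[OF tendsto_norm[OF R]], intro exI allI impI)
    fix n
    show "norm (T n x) \<le> norm x * norm S"
      using norm_le_of_dominated[of "T n" S x] ub pos' by (simp add: mult.commute)
  qed
  have "bounded_linear R"
  proof (rule bounded_linear_intro[OF _ _ bound])
    show "R (x + y) = R x + R y" for x y
      using LIMSEQ_unique[OF R[of "x + y"]] tendsto_add[OF R[of x] R[of y]]
      by (simp add: blinfun.add_right)
    show "R (c *\<^sub>R x) = c *\<^sub>R R x" for c x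
      using LIMSEQ_unique[OF R[of "c *\<^sub>R x"]] tendsto_scaleR[OF tendsto_const R[of x]]
      by (simp add: blinfun.scaleR_right)
  qed
  then have RB: "blinfun_apply (Blinfun R) = R" by (rule bounded_linear_Blinfun_apply)
  have above: "T n x \<le> R x" if "0 \<le> x" for n x
    using conv[OF that] LIMSEQ_unique[OF R[of x]] by blast
  have "positive_map R"
    using above pos' unfolding positive_map_def by (meson order_trans)
  \<comment> \<open>The supremum \<open>S\<close> is least among regular upper bounds only, so the
    limit has to be known to be positive, hence regular, before it can be compared.\<close>
  then have "operator_le S (Blinfun R)"
    using above by (intro least positive_map_imp_regular) (auto simp: RB operator_le_iff)
  then have "R x = S x" if "0 \<le> x" for x
    using LIMSEQ_mono[OF R[of x] tendsto_const] ub that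
    by (intro antisym) (auto simp: RB operator_le_iff)
  then have "R (pprt x) = S (pprt x)" "R (- nprt x) = S (- nprt x)" by simp_all
  then have "R x = S x"
    using blinfun_apply_prts[of "Blinfun R" x] blinfun_apply_prts[of S x] by (simp add: RB)
  then show ?thesis using R[of x] by simp
qed

section \<open>Positive representations and spectral measures\<close>

text \<open>The pointwise supremum is measurable, lies between \<open>\<phi> 0\<close> and
  \<open>\<psi>\<close>, and vanishes off \<open>X\<close>. It is thus an upper bound inside B(X),
  so the order supremum cannot exceed it.\<close>

lemma increases_to_bounded_measurable_pointwise:
  assumes inc: "increases_to (bounded_measurable X \<Omega>) (\<le>) \<phi> \<psi>"
  shows "(\<lambda>n. \<phi> n x) \<longlonglongrightarrow> \<psi> x"
proof -
  have mem: "\<And>n. \<phi> n \<in> bounded_measurable X \<Omega>" "\<psi> \<in> bounded_measurable X \<Omega>"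
    and mono: "\<And>n x. \<phi> n x \<le> \<phi> (Suc n) x" and ub: "\<And>n x. \<phi> n x \<le> \<psi> x"
    and least: "\<And>u. u \<in> bounded_measurable X \<Omega> \<Longrightarrow> (\<And>n. \<phi> n \<le> u) \<Longrightarrow> \<psi> \<le> u"
    using inc by (auto simp: increases_to_def le_fun_def)
  define \<theta> where "\<theta> x = (SUP n. \<phi> n x)" for x
  have bdd: "bdd_above (range (\<lambda>n. \<phi> n x))" for x
    using ub by (intro bdd_aboveI2)
  have up: "\<phi> n x \<le> \<theta> x" for n x
    unfolding \<theta>_def by (rule cSUP_upper[OF _ bdd]) simp
  have le: "\<theta> x \<le> \<psi> x" for x
    unfolding \<theta>_def using ub by (intro cSUP_least) auto
  have "\<theta> \<in> bounded_measurable X \<Omega>"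
    unfolding bounded_measurable_def
  proof (intro CollectI conjI allI impI)
    show "\<theta> \<in> borel_measurable (sigma X \<Omega>)"
      unfolding \<theta>_def using mem bdd
      by (intro borel_measurable_cSUP) (auto simp: bounded_measurable_def)
    obtain B C where B: "\<And>x. \<bar>\<phi> 0 x\<bar> \<le> B" and C: "\<And>x. \<bar>\<psi> x\<bar> \<le> C"
      using mem(1)[of 0] mem(2) by (auto simp: bounded_measurable_def bounded_iff)
    have "\<bar>\<theta> x\<bar> \<le> max B C" for x
      using up[of 0 x] le[of x] B[of x] C[of x] by linarith
    then show "bounded (range \<theta>)" by (auto simp: bounded_iff)
    show "\<theta> x = 0" if "x \<notin> X" for x
      using that mem by (simp add: \<theta>_def bounded_measurable_def)
  qed
  then have "\<psi> \<le> \<theta>" using up by (intro least) (auto simp: le_fun_def)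
  then have "\<theta> x = \<psi> x" using le[of x] by (simp add: le_fun_def antisym)
  moreover have "(\<lambda>n. \<phi> n x) \<longlonglongrightarrow> (SUP n. \<phi> n x)"
    using mono by (intro LIMSEQ_incseq_SUP bdd incseq_SucI)
  ultimately show ?thesis by (simp add: \<theta>_def)
qed

section \<open>Monotonicity and automatic boundedness of positive representations\<close>

lemma bounded_measurable_diff:
  assumes "\<phi> \<in> bounded_measurable X \<Omega>" "\<psi> \<in> bounded_measurable X \<Omega>"
  shows "(\<lambda>x. \<phi> x - \<psi> x) \<in> bounded_measurable X \<Omega>"
  using bounded_measurable_add[OF assms(1) bounded_measurable_scale[OF assms(2), of "- 1"]] by simp

lemma linear_on_bounded_measurable_add:
  assumes "linear_on_bounded_measurable X \<Omega> \<pi>"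
    and "\<phi> \<in> bounded_measurable X \<Omega>" "\<psi> \<in> bounded_measurable X \<Omega>"
  shows "\<pi> (\<lambda>x. \<phi> x + \<psi> x) = \<pi> \<phi> + \<pi> \<psi>"
  using assms unfolding linear_on_bounded_measurable_def by blast

lemma linear_on_bounded_measurable_scale:
  assumes "linear_on_bounded_measurable X \<Omega> \<pi>" and "\<phi> \<in> bounded_measurable X \<Omega>"
  shows "\<pi> (\<lambda>x. c * \<phi> x) = c *\<^sub>R \<pi> \<phi>"
  using assms unfolding linear_on_bounded_measurable_def by blast

lemma linear_on_bounded_measurable_diff:
  assumes "linear_on_bounded_measurable X \<Omega> \<pi>"
    and "\<phi> \<in> bounded_measurable X \<Omega>" "\<psi> \<in> bounded_measurable X \<Omega>"
  shows "\<pi> (\<lambda>x. \<phi> x - \<psi> x) = \<pi> \<phi> - \<pi> \<psi>"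
  using linear_on_bounded_measurable_add[OF assms(1,2) bounded_measurable_scale[OF assms(3), of "- 1"]]
    linear_on_bounded_measurable_scale[OF assms(1,3), of "- 1"]
  by simp

lemma positive_representation_mono:
  assumes rep: "positive_representation X \<Omega> \<pi>"
    and mem: "\<phi> \<in> bounded_measurable X \<Omega>" "\<psi> \<in> bounded_measurable X \<Omega>"
    and le: "\<And>x. \<phi> x \<le> \<psi> x" and z: "0 \<le> z"
  shows "\<pi> \<phi> z \<le> \<pi> \<psi> z"
proof -
  have "positive_map (\<pi> (\<lambda>x. \<psi> x - \<phi> x))"
    using rep bounded_measurable_diff[OF mem(2,1)] le by (auto simp: positive_representation_def)
  moreover have "\<pi> (\<lambda>x. \<psi> x - \<phi> x) = \<pi> \<psi> - \<pi> \<phi>"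
    using rep mem
    by (intro linear_on_bounded_measurable_diff) (auto simp: positive_representation_def)
  ultimately show ?thesis
    using z by (simp add: positive_map_def blinfun.diff_left)
qed

text \<open>Applying \<pi> to the bounds of \<phi> by plus and minus \<open>sup_norm \<phi>\<close>
  times the indicator of \<open>X\<close> shows that \<open>\<pi> \<phi>\<close> is dominated on the
  cone by a multiple of \<open>\<pi> (indicat_real X)\<close>. The indicator stands for the constant
  1, since members of B(X) vanish off \<open>X\<close>.\<close>

lemma positive_representation_norm_le:
  fixes \<pi> :: "('x \<Rightarrow> real) \<Rightarrow> 'e::banach_lattice \<Rightarrow>\<^sub>L 'e"
  assumes sa: "sigma_algebra X \<Omega>" and rep: "positive_representation X \<Omega> \<pi>"
    and \<phi>: "\<phi> \<in> bounded_measurable X \<Omega>"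
  shows "norm (\<pi> \<phi>) \<le> norm (\<pi> (indicat_real X)) * sup_norm \<phi>"
proof -
  have lin: "linear_on_bounded_measurable X \<Omega> \<pi>"
    using rep by (simp add: positive_representation_def)
  have X: "indicat_real X \<in> bounded_measurable X \<Omega>"
    using sa by (intro indicator_bounded_measurable)
      (auto simp: sigma_algebra_iff2 dest: bspec[of _ _ "{}"])
  obtain M where "\<And>x. \<bar>\<phi> x\<bar> \<le> M"
    using \<phi> by (auto simp: bounded_measurable_def bounded_iff)
  then have bdd: "bdd_above (range (\<lambda>x. \<bar>\<phi> x\<bar>))" by (intro bdd_aboveI2)
  have sup: "\<bar>\<phi> x\<bar> \<le> sup_norm \<phi>" for x
    unfolding sup_norm_def by (rule cSUP_upper[OF _ bdd]) simp
  have sup': "\<bar>\<phi> x\<bar> \<le> sup_norm \<phi> * indicat_real X x" for x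
    using sup[of x] \<phi> by (cases "x \<in> X") (auto simp: bounded_measurable_def)
  have sup0: "0 \<le> sup_norm \<phi>" using order_trans[OF abs_ge_zero sup] .
  let ?S = "sup_norm \<phi> *\<^sub>R \<pi> (indicat_real X)"
  have S: "\<pi> (\<lambda>x. sup_norm \<phi> * indicat_real X x) = ?S"
    by (rule linear_on_bounded_measurable_scale[OF lin X])
  have dom: "\<bar>\<pi> \<phi> z\<bar> \<le> ?S z" if z: "0 \<le> z" for z
  proof (rule abs_leI)
    show "\<pi> \<phi> z \<le> ?S z"
      unfolding S[symmetric] using sup'
      by (intro positive_representation_mono[OF rep \<phi> bounded_measurable_scale[OF X] _ z])
         (simp add: abs_le_iff)
    have "\<pi> (\<lambda>x. - 1 * \<phi> x) z \<le> \<pi> (\<lambda>x. sup_norm \<phi> * indicat_real X x) z"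
      using sup'
      by (intro positive_representation_mono[OF rep bounded_measurable_scale[OF \<phi>]
            bounded_measurable_scale[OF X] _ z])
         (simp add: abs_le_iff)
    then show "- \<pi> \<phi> z \<le> ?S z"
      unfolding S linear_on_bounded_measurable_scale[OF lin \<phi>] by (simp add: blinfun.minus_left)
  qed
  have "norm (\<pi> \<phi>) \<le> norm ?S"
    by (rule norm_blinfun_bound[OF norm_ge_zero]) (rule norm_le_of_dominated[OF dom])
  also have "\<dots> = norm (\<pi> (indicat_real X)) * sup_norm \<phi>"
    using sup0 by simp
  finally show ?thesis .
qed

section \<open>From a generating spectral measure to sigma-order continuity\<close>

text \<open>The layers \<open>A n - A (Suc n)\<close> are disjoint with union \<open>A 0\<close>.
  Their series telescopes to \<open>P (A 0) z - P (A n) z\<close>, while countable additivity says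
  that it converges to \<open>P (A 0) z\<close>.\<close>

lemma spectral_measure_continuous_from_above:
  fixes P :: "'x set \<Rightarrow> 'e::banach_lattice \<Rightarrow>\<^sub>L 'e" and A :: "nat \<Rightarrow> 'x set"
  assumes sa: "sigma_algebra X \<Omega>" and P: "positive_spectral_measure \<Omega> P"
    and gen: "generated_by X \<Omega> P \<pi>"
    and A: "\<And>n. A n \<in> \<Omega>" "\<And>n. A (Suc n) \<subseteq> A n" "(\<Inter>n. A n) = {}"
  shows "(\<lambda>n. P (A n) z) \<longlonglongrightarrow> 0"
proof -
  interpret sigma_algebra X \<Omega> by fact
  define D where "D n = A n - A (Suc n)" for n
  have anti: "A m \<subseteq> A n" if "n \<le> m" for n m
    using lift_Suc_antimono_le[of A, OF A(2) that] .
  have D: "range D \<subseteq> \<Omega>" using A(1) by (auto simp: D_def)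
  have disj: "disjoint_family D"
    unfolding disjoint_family_on_def
  proof (intro ballI impI)
    fix m n :: nat assume "m \<noteq> n"
    then show "D m \<inter> D n = {}"
      using anti[of "Suc m" n] anti[of "Suc n" m] by (cases m n rule: linorder_cases) (auto simp: D_def)
  qed
  have "(\<Union>n. D n) = A 0"
  proof (intro equalityI subsetI)
    fix x assume x: "x \<in> A 0"
    show "x \<in> (\<Union>n. D n)"
    proof (rule ccontr)
      assume no: "x \<notin> (\<Union>n. D n)"
      have "x \<in> A n" for n by (induction n) (use x no in \<open>auto simp: D_def\<close>)
      then show False using A(3) by blast
    qed
  qed (use anti[of 0] in \<open>auto simp: D_def\<close>)
  moreover have "(\<lambda>n. P (D n) z) sums P (\<Union>n. D n) z"
    using P D disj by (auto simp: positive_spectral_measure_def)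
  moreover have "P (D n) = P (A n) - P (A (Suc n))" for n
  proof -
    have "indicat_real (D n) = (\<lambda>x. indicat_real (A n) x - indicat_real (A (Suc n)) x)"
      using A(2)[of n] by (auto simp: D_def indicator_def fun_eq_iff)
    then have "\<pi> (indicat_real (D n)) = \<pi> (indicat_real (A n)) - \<pi> (indicat_real (A (Suc n)))"
      using gen A(1) indicator_bounded_measurable[OF sa]
      by (simp add: linear_on_bounded_measurable_diff[of X \<Omega>] generated_by_def)
    moreover have "D n \<in> \<Omega>" using D by auto
    ultimately show ?thesis using gen A(1) by (auto simp: generated_by_def)
  qed
  ultimately have "(\<lambda>n. \<Sum>k<n. P (A k) z - P (A (Suc k)) z) \<longlonglongrightarrow> P (A 0) z"
    by (simp add: sums_def blinfun.diff_left)
  then have "(\<lambda>n. P (A 0) z - P (A n) z) \<longlonglongrightarrow> P (A 0) z"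
    by (simp add: sum_lessThan_telescope'[of "\<lambda>k. P (A k) z"])
  from tendsto_diff[OF tendsto_const[of "P (A 0) z"] this] show ?thesis by simp
qed

text \<open>
  With \<open>g\<^sub>n = \<psi> - \<phi>\<^sub>n\<close> bounded by \<open>M\<close>, split \<open>X\<close> along \<open>A\<^sub>n = {g\<^sub>n > e}\<close>: then
  \<open>g\<^sub>n \<le> e \<chi>\<^sub>X + M \<chi>\<^bsub>A\<^sub>n\<^esub>\<close> and the sets \<open>A\<^sub>n\<close> decrease to the empty set.
\<close>

lemma generated_representation_converges:
  fixes \<pi> :: "('x \<Rightarrow> real) \<Rightarrow> 'e::banach_lattice \<Rightarrow>\<^sub>L 'e"
  assumes sa: "sigma_algebra X \<Omega>" and rep: "positive_representation X \<Omega> \<pi>"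
    and P: "positive_spectral_measure \<Omega> P" and gen: "generated_by X \<Omega> P \<pi>"
    and inc: "increases_to (bounded_measurable X \<Omega>) (\<le>) \<phi> \<psi>" and z: "0 \<le> z"
  shows "(\<lambda>n. \<pi> (\<phi> n) z) \<longlonglongrightarrow> \<pi> \<psi> z"
proof -
  interpret sigma_algebra X \<Omega> by fact
  let ?B = "bounded_measurable X \<Omega>"
  have lin: "linear_on_bounded_measurable X \<Omega> \<pi>"
    using rep by (simp add: positive_representation_def)
  have mem: "\<And>n. \<phi> n \<in> ?B" "\<psi> \<in> ?B"
    and mono: "\<And>n x. \<phi> n x \<le> \<phi> (Suc n) x" and ub: "\<And>n x. \<phi> n x \<le> \<psi> x"
    using inc by (auto simp: increases_to_def le_fun_def)
  define g where "g n = (\<lambda>x. \<psi> x - \<phi> n x)" for n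
  have g: "g n \<in> ?B" for n unfolding g_def by (rule bounded_measurable_diff[OF mem(2,1)])
  have g0: "0 \<le> g n x" for n x using ub by (simp add: g_def)
  have gdec: "g (Suc n) x \<le> g n x" for n x using mono by (simp add: g_def)
  have glim: "(\<lambda>n. g n x) \<longlonglongrightarrow> 0" for x
    using tendsto_diff[OF tendsto_const increases_to_bounded_measurable_pointwise[OF inc], of "\<psi> x" x]
    by (simp add: g_def)
  obtain M where M: "\<And>x. \<bar>g 0 x\<bar> \<le> M"
    using g[of 0] by (auto simp: bounded_measurable_def bounded_iff)
  have M0: "0 \<le> M" using order_trans[OF abs_ge_zero M] .
  have gM: "g n x \<le> M" for n x
    using lift_Suc_antimono_le[of "\<lambda>n. g n x", OF gdec, of 0 n] M[of x] by simp
  have pos: "0 \<le> \<pi> (g n) z" for n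
    using rep g g0 z by (auto simp: positive_representation_def positive_map_def)
  have "(\<lambda>n. norm (\<pi> (g n) z)) \<longlonglongrightarrow> 0"
  proof (rule LIMSEQ_I)
    fix r :: real assume r: "0 < r"
    \<comment> \<open>The summand 1 keeps the denominator positive when \<open>P X z\<close>
      vanishes.\<close>
    define e where "e = r / (2 * (norm (P X z) + 1))"
    have e: "0 < e" unfolding e_def using r by (intro divide_pos_pos) (simp_all add: add_nonneg_pos)
    have eP: "e * norm (P X z) < r / 2"
    proof -
      have "e * (norm (P X z) + 1) = r / 2"
        unfolding e_def using add_nonneg_pos[OF norm_ge_zero zero_less_one, of "P X z"]
        by (simp add: field_simps)
      then show ?thesis using e by (simp add: distrib_left)
    qed
    define A where "A n = {x \<in> X. e < g n x}" for n
    have sp: "space (sigma X \<Omega>) = X" "sets (sigma X \<Omega>) = \<Omega>"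
      using space_closed by (simp_all add: sigma_sets_eq)
    have A: "A n \<in> \<Omega>" for n
    proof -
      have [measurable]: "g n \<in> borel_measurable (sigma X \<Omega>)"
        using g by (simp add: bounded_measurable_def)
      have "{x \<in> space (sigma X \<Omega>). e < g n x} \<in> sets (sigma X \<Omega>)" by measurable
      then show ?thesis by (simp add: sp A_def)
    qed
    have Adec: "A (Suc n) \<subseteq> A n" for n
      unfolding A_def using gdec by (auto intro: less_le_trans)
    have "(\<Inter>n. A n) = {}"
    proof (rule ccontr)
      assume "(\<Inter>n. A n) \<noteq> {}"
      then obtain x where "\<forall>n. x \<in> A n" by auto
      then have "\<And>n. e \<le> g n x" by (simp add: A_def less_imp_le)
      then have "e \<le> 0" by (intro LIMSEQ_le_const[OF glim]) auto
      then show False using e by simp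
    qed
    from spectral_measure_continuous_from_above[OF sa P gen A Adec this]
    have "(\<lambda>n. M * norm (P (A n) z)) \<longlonglongrightarrow> M * norm (0 :: 'e)"
      by (intro tendsto_mult tendsto_norm tendsto_const)
    then obtain N where N: "\<And>n. n \<ge> N \<Longrightarrow> M * norm (P (A n) z) < r / 2"
      using r M0 by (force dest!: LIMSEQ_D[of _ _ "r / 2"] simp: abs_mult)
    have "norm (\<pi> (g n) z) < r" if n: "n \<ge> N" for n
    proof -
      have iX: "indicat_real X \<in> ?B" and iA: "indicat_real (A n) \<in> ?B"
        using A indicator_bounded_measurable[OF sa] by auto
      note sX = bounded_measurable_scale[OF iX, of e] and sA = bounded_measurable_scale[OF iA, of M]
      have dom: "g n x \<le> e * indicat_real X x + M * indicat_real (A n) x" for x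
      proof (cases "x \<in> X")
        case True
        then show ?thesis using gM[of n x] e by (cases "x \<in> A n") (auto simp: A_def)
      next
        case False
        then show ?thesis using g[of n] by (auto simp: bounded_measurable_def A_def)
      qed
      have "\<pi> (g n) z \<le> \<pi> (\<lambda>x. e * indicat_real X x + M * indicat_real (A n) x) z"
        by (rule positive_representation_mono[OF rep g bounded_measurable_add[OF sX sA] dom z])
      also have "\<pi> (\<lambda>x. e * indicat_real X x + M * indicat_real (A n) x) =
          \<pi> (\<lambda>x. e * indicat_real X x) + \<pi> (\<lambda>x. M * indicat_real (A n) x)"
        by (rule linear_on_bounded_measurable_add[OF lin sX sA])
      also have "\<dots> = e *\<^sub>R P X + M *\<^sub>R P (A n)"
        using gen A iX iA by (simp add: linear_on_bounded_measurable_scale[OF lin] generated_by_def)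
      finally have "norm (\<pi> (g n) z) \<le> norm (e *\<^sub>R P X z + M *\<^sub>R P (A n) z)"
        by (intro norm_mono_nonneg[OF pos]) (simp add: blinfun.add_left blinfun.scaleR_left)
      also have "\<dots> \<le> e * norm (P X z) + M * norm (P (A n) z)"
        using norm_triangle_ineq[of "e *\<^sub>R P X z" "M *\<^sub>R P (A n) z"] e M0 by simp
      also have "\<dots> < r" using eP N[OF n] by simp
      finally show ?thesis .
    qed
    then show "\<exists>N. \<forall>n\<ge>N. norm (norm (\<pi> (g n) z) - 0) < r" by auto
  qed
  then have "(\<lambda>n. \<pi> (g n) z) \<longlonglongrightarrow> 0" by (rule tendsto_norm_zero_cancel)
  then have "(\<lambda>n. \<pi> \<psi> z - \<pi> (\<phi> n) z) \<longlonglongrightarrow> 0"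
    unfolding g_def linear_on_bounded_measurable_diff[OF lin mem(2,1)] blinfun.diff_left .
  from tendsto_diff[OF tendsto_const[of "\<pi> \<psi> z"] this] show ?thesis by simp
qed

section \<open>From sigma-order continuity to a spectral measure\<close>

lemma increases_to_indicator:
  assumes sa: "sigma_algebra X \<Omega>" and A: "\<And>n. A n \<in> \<Omega>" "\<And>n. A n \<subseteq> A (Suc n)"
  shows "increases_to (bounded_measurable X \<Omega>) (\<le>)
    (\<lambda>n. indicat_real (A n)) (indicat_real (\<Union>n. A n))"
proof -
  interpret sigma_algebra X \<Omega> by fact
  have "indicat_real (\<Union>n. A n) x \<le> u x" if u: "\<And>n x. indicat_real (A n) x \<le> u x" for u x
  proof (cases "x \<in> (\<Union>n. A n)")
    case True
    then obtain n where "x \<in> A n" by blast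
    then show ?thesis using True u[of n x] by simp
  next
    case False
    then show ?thesis using u[of 0 x] by simp
  qed
  moreover have "(\<Union>n. A n) \<in> \<Omega>" using A(1) by auto
  ultimately show ?thesis
    using A(1) subsetD[OF A(2)] unfolding increases_to_def le_fun_def
    by (auto intro!: indicator_bounded_measurable[OF sa] indicator_leI)
qed

text \<open>Indicators multiply under intersection, so multiplicativity of \<pi> yields projections
  and the intersection rule. Countable additivity is order continuity along the finite partial
  unions, made strong by \<open>increasing_operators_converge\<close>.\<close>

lemma sigma_order_continuous_imp_spectral_measure:
  fixes \<pi> :: "('x \<Rightarrow> real) \<Rightarrow> 'e::banach_lattice \<Rightarrow>\<^sub>L 'e"
  assumes sa: "sigma_algebra X \<Omega>" and complete: "sigma_Dedekind_complete (UNIV :: 'e set)"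
    and norm: "sigma_order_continuous_norm TYPE('e)"
    and rep: "positive_representation X \<Omega> \<pi>"
    and cont: "sigma_order_continuous (bounded_measurable X \<Omega>) (\<le>) regular_operators operator_le \<pi>"
  shows "positive_spectral_measure \<Omega> (\<lambda>A. \<pi> (indicat_real A))"
proof -
  interpret sigma_algebra X \<Omega> by fact
  have lin: "linear_on_bounded_measurable X \<Omega> \<pi>"
    using rep by (simp add: positive_representation_def)
  note ind = indicator_bounded_measurable[OF sa]
  have pos: "positive_map (\<pi> (indicat_real A))" if "A \<in> \<Omega>" for A
    using rep ind[OF that] by (auto simp: positive_representation_def)
  have inter: "\<pi> (indicat_real (A \<inter> B)) = \<pi> (indicat_real A) o\<^sub>L \<pi> (indicat_real B)"
    if "A \<in> \<Omega>" "B \<in> \<Omega>" for A B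
  proof -
    have "indicat_real (A \<inter> B) = (\<lambda>x. indicat_real A x * indicat_real B x)"
      by (auto simp: indicator_def)
    then show ?thesis
      using rep ind[OF that(1)] ind[OF that(2)] unfolding positive_representation_def by metis
  qed
  have empty: "\<pi> (indicat_real {}) = 0"
  proof -
    have "(\<lambda>x. 0 * indicat_real {} x) = indicat_real {}" by (simp add: fun_eq_iff)
    from arg_cong[OF this, of \<pi>] have "\<pi> (indicat_real {}) = 0 *\<^sub>R \<pi> (indicat_real {})"
      unfolding linear_on_bounded_measurable_scale[OF lin ind[OF empty_sets]] by (rule sym)
    then show ?thesis by simp
  qed
  have sums: "(\<lambda>n. \<pi> (indicat_real (D n)) x) sums \<pi> (indicat_real (\<Union>n. D n)) x"
    if D: "range D \<subseteq> \<Omega>" "disjoint_family D" for D :: "nat \<Rightarrow> 'x set" and x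
  proof -
    \<comment> \<open>The strict bound \<open>k < n\<close> makes \<open>A 0\<close> empty and
      matches the partial sums in \<open>sums\<close>.\<close>
    define A where "A n = (\<Union>k<n. D k)" for n
    have A: "A n \<in> \<Omega>" "A n \<subseteq> A (Suc n)" for n
      using D(1) by (auto simp: A_def lessThan_Suc intro!: finite_UN)
    have "(\<Union>n. A n) = (\<Union>n. D n)" by (auto simp: A_def)
    then have "increases_to regular_operators operator_le
        (\<lambda>n. \<pi> (indicat_real (A n))) (\<pi> (indicat_real (\<Union>n. D n)))"
      using cont increases_to_indicator[of X \<Omega> A, OF sa A] by (simp add: sigma_order_continuous_def)
    from increasing_operators_converge[OF complete norm pos[OF A(1)] this]
    have "(\<lambda>n. \<pi> (indicat_real (A n)) x) \<longlonglongrightarrow> \<pi> (indicat_real (\<Union>n. D n)) x" .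
    moreover have "\<pi> (indicat_real (A n)) = (\<Sum>k<n. \<pi> (indicat_real (D k)))" for n
    proof (induction n)
      case 0
      have "A 0 = {}" by (simp add: A_def)
      then show ?case by (simp only: empty lessThan_0 sum.empty)
    next
      case (Suc n)
      have "D n \<inter> D k = {}" if "k < n" for k
        using D(2) that by (auto simp: disjoint_family_on_def)
      then have "indicat_real (A (Suc n)) = (\<lambda>x. indicat_real (A n) x + indicat_real (D n) x)"
        by (auto simp: A_def indicator_def fun_eq_iff lessThan_Suc)
      moreover have "D n \<in> \<Omega>" using D(1) by auto
      ultimately have "\<pi> (indicat_real (A (Suc n))) = \<pi> (indicat_real (A n)) + \<pi> (indicat_real (D n))"
        using ind A(1) by (simp add: linear_on_bounded_measurable_add[OF lin])
      then show ?case using Suc by simp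
    qed
    ultimately show ?thesis by (simp add: sums_def blinfun.sum_left)
  qed
  show ?thesis
    unfolding positive_spectral_measure_def
  proof (intro conjI ballI allI impI)
    fix A assume A: "A \<in> \<Omega>"
    show "positive_map (\<pi> (indicat_real A))" by (rule pos[OF A])
    then show "\<pi> (indicat_real A) \<in> regular_operators" by (rule positive_map_imp_regular)
    show "\<pi> (indicat_real A) o\<^sub>L \<pi> (indicat_real A) = \<pi> (indicat_real A)"
      using inter[OF A A] by simp
  qed (use empty inter sums in auto)
qed

theorem theorem4p8:
  fixes X :: "'x set" and \<Omega> :: "'x set set"
    and \<pi> :: "('x \<Rightarrow> real) \<Rightarrow> 'e::banach_lattice \<Rightarrow>\<^sub>L 'e"
  assumes "sigma_algebra X \<Omega>"
    and "sigma_Dedekind_complete (UNIV :: 'e set)"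
    and "positive_representation X \<Omega> \<pi>"
    and "\<pi> ` bounded_measurable X \<Omega> \<subseteq> regular_operators"
  shows "((\<forall>f :: 'e \<Rightarrow>\<^sub>L real. sigma_order_continuous_functional f) \<longleftrightarrow>
            sigma_order_continuous_norm TYPE('e)) \<and>
         ((\<forall>f :: 'e \<Rightarrow>\<^sub>L real. sigma_order_continuous_functional f) \<longrightarrow>
            ((\<exists>P. positive_spectral_measure \<Omega> P \<and> generated_by X \<Omega> P \<pi>) \<longleftrightarrow>
             sigma_order_continuous (bounded_measurable X \<Omega>) (\<le>) regular_operators operator_le \<pi>))"
  unfolding sigma_order_continuous_functional_iff_norm
proof (intro conjI impI iffI refl)
  assume "\<exists>P. positive_spectral_measure \<Omega> P \<and> generated_by X \<Omega> P \<pi>"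
  then obtain P where P: "positive_spectral_measure \<Omega> P" "generated_by X \<Omega> P \<pi>" by blast
  show "sigma_order_continuous (bounded_measurable X \<Omega>) (\<le>) regular_operators operator_le \<pi>"
    unfolding sigma_order_continuous_def
  proof (intro allI impI)
    fix \<phi> \<psi> assume inc: "increases_to (bounded_measurable X \<Omega>) (\<le>) \<phi> \<psi>"
    have mem: "\<And>n. \<phi> n \<in> bounded_measurable X \<Omega>" "\<psi> \<in> bounded_measurable X \<Omega>"
      and mono: "\<And>n x. \<phi> n x \<le> \<phi> (Suc n) x" and ub: "\<And>n x. \<phi> n x \<le> \<psi> x"
      using inc by (auto simp: increases_to_def le_fun_def)
    \<comment> \<open>Norm convergence at each \<open>z\<close> in the cone lets any upper bound
      \<open>U\<close> pass to the limit, so \<open>\<pi> \<psi>\<close> is the least one.\<close>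
    have "\<pi> \<psi> z \<le> U z" if "\<And>n. operator_le (\<pi> (\<phi> n)) U" "0 \<le> z" for U z
      using LIMSEQ_mono[OF generated_representation_converges[OF assms(1,3) P inc that(2)] tendsto_const]
        that by (auto simp: operator_le_iff)
    then show "increases_to regular_operators operator_le (\<lambda>n. \<pi> (\<phi> n)) (\<pi> \<psi>)"
      unfolding increases_to_def using assms(4) mem mono ub
      by (auto simp: operator_le_iff intro!: positive_representation_mono[OF assms(3)])
  qed
next
  assume norm: "sigma_order_continuous_norm TYPE('e)"
    and cont: "sigma_order_continuous (bounded_measurable X \<Omega>) (\<le>) regular_operators operator_le \<pi>"
  have "generated_by X \<Omega> (\<lambda>A. \<pi> (indicat_real A)) \<pi>"
    unfolding generated_by_def
    using positive_representation_norm_le[OF assms(1,3)] assms(3)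
    by (auto simp: positive_representation_def)
  then show "\<exists>P. positive_spectral_measure \<Omega> P \<and> generated_by X \<Omega> P \<pi>"
    using sigma_order_continuous_imp_spectral_measure[OF assms(1,2) norm assms(3) cont] by blast
qed

end
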